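(* The fractional chromatic numbers and the ordinary chromatic numbers of the total cyclic interval graph $\mathrm{CG}(n)$ and of the total Kneser graph $\mathrm{KG}(n)$ ($n\ge 2$) are all $\Theta(n\log n)$; that is, each of $\chi_f(\mathrm{CG}(n))$, $\chi(\mathrm{CG}(n))$, $\chi_f(\mathrm{KG}(n))$, $\chi(\mathrm{KG}(n))$ is $\Theta(n\log n)$ as a function of $n$.
   Context: For $n\ge 2$, the total Kneser graph $\mathrm{KG}(n)$ is the graph whose vertices are the partitions of $\{1,\dots,n\}$ into an unordered pair $(A,B)$ of non-empty disjoint subsets. Two partitions $(A,B)$ and $(C,D)$ are nested if one of $A$ or $B$ is contained in one of $C$ or $D$. The edges of $\mathrm{KG}(n)$ are the pairs of distinct nested partitions. A cyclic interval is a cyclic shift modulo $n$ of a set $\{1,\dots,k\}$. The total cyclic interval graph $\mathrm{CG}(n)$ is the subgraph of $\mathrm{KG}(n)$ induced on the partitions whose parts are cyclic intervals. $\chi$ denotes the chromatic number and $\chi_f$ the fractional chromatic number. For real-valued functions, $f=O(g)$ means there is an absolute constant $C>0$ with $f\le C\cdot g$; $f=\Omega(g)$ means $g=O(f)$; $f=\Theta(g)$ means both. $\log$ is the natural logarithm. *)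

theory Defs
  imports Complex_Main
begin

record 'a graph =
  verts :: "'a set"
  edges :: "'a set set"

definition induced_subgraph :: "'a graph \<Rightarrow> 'a set \<Rightarrow> 'a graph" where
  "induced_subgraph G W = \<lparr>verts = verts G \<inter> W, edges = {e \<in> edges G. e \<subseteq> W}\<rparr>"

definition independent_sets :: "'a graph \<Rightarrow> 'a set set" where
  "independent_sets G = {S. S \<subseteq> verts G \<and> (\<forall>u\<in>S. \<forall>v\<in>S. {u, v} \<notin> edges G)}"

definition proper_coloring :: "'a graph \<Rightarrow> nat \<Rightarrow> ('a \<Rightarrow> nat) \<Rightarrow> bool" where
  "proper_coloring G k c \<longleftrightarrow>
     (\<forall>v\<in>verts G. c v < k) \<and>
     (\<forall>u\<in>verts G. \<forall>v\<in>verts G. {u, v} \<in> edges G \<longrightarrow> c u \<noteq> c v)"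

definition chromatic_number :: "'a graph \<Rightarrow> nat" where
  "chromatic_number G = (LEAST k. \<exists>c. proper_coloring G k c)"

definition fractional_coloring :: "'a graph \<Rightarrow> ('a set \<Rightarrow> real) \<Rightarrow> bool" where
  "fractional_coloring G w \<longleftrightarrow>
     (\<forall>S\<in>independent_sets G. w S \<ge> 0) \<and>
     (\<forall>v\<in>verts G. (\<Sum>S | S \<in> independent_sets G \<and> v \<in> S. w S) \<ge> 1)"

text \<open>Minimal total weight of a fractional coloring; meaningful for finite loopless graphs.\<close>

definition fractional_chromatic_number :: "'a graph \<Rightarrow> real" where
  "fractional_chromatic_number G =
     Inf {\<Sum>S\<in>independent_sets G. w S | w. fractional_coloring G w}"

text \<open>The unordered pair \<open>(A, B)\<close> is encoded as the two-element set \<open>{A, B}\<close>.\<close>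

definition bipartitions :: "nat \<Rightarrow> nat set set set" where
  "bipartitions n =
     {{A, B} | A B. A \<noteq> {} \<and> B \<noteq> {} \<and> A \<inter> B = {} \<and> A \<union> B = {1..n}}"

definition nested :: "nat set set \<Rightarrow> nat set set \<Rightarrow> bool" where
  "nested P Q \<longleftrightarrow> (\<exists>X\<in>P. \<exists>Y\<in>Q. X \<subseteq> Y)"

text \<open>On \<open>bipartitions n\<close> the relation \<open>nested\<close> is symmetric, by passing to complements.\<close>

definition KG :: "nat \<Rightarrow> nat set set graph" where
  "KG n =
     \<lparr>verts = bipartitions n,
      edges = {{P, Q} | P Q. P \<in> bipartitions n \<and> Q \<in> bipartitions n \<and> P \<noteq> Q \<and> nested P Q}\<rparr>"

text \<open>Addition of \<open>s\<close> modulo \<open>n\<close> with residues represented in \<open>{1..n}\<close> instead of \<open>{0..<n}\<close>.\<close>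

definition cyclic_shift :: "nat \<Rightarrow> nat \<Rightarrow> nat \<Rightarrow> nat" where
  "cyclic_shift n s x = (x - 1 + s) mod n + 1"

definition cyclic_interval :: "nat \<Rightarrow> nat set \<Rightarrow> bool" where
  "cyclic_interval n A \<longleftrightarrow> (\<exists>k\<in>{1..n}. \<exists>s. A = cyclic_shift n s ` {1..k})"

definition CG :: "nat \<Rightarrow> nat set set graph" where
  "CG n = induced_subgraph (KG n) {P. \<forall>X\<in>P. cyclic_interval n X}"

text \<open>Non-asymptotic variants of the Landau symbols: the bound holds with an absolute constant
  on all of \<open>D\<close>, not merely eventually.\<close>

definition bigo_on :: "'a set \<Rightarrow> ('a \<Rightarrow> real) \<Rightarrow> ('a \<Rightarrow> real) \<Rightarrow> bool" where
  "bigo_on D f g \<longleftrightarrow> (\<exists>C>0. \<forall>x\<in>D. f x \<le> C * g x)"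

definition bigomega_on :: "'a set \<Rightarrow> ('a \<Rightarrow> real) \<Rightarrow> ('a \<Rightarrow> real) \<Rightarrow> bool" where
  "bigomega_on D f g \<longleftrightarrow> bigo_on D g f"

definition bigtheta_on :: "'a set \<Rightarrow> ('a \<Rightarrow> real) \<Rightarrow> ('a \<Rightarrow> real) \<Rightarrow> bool" where
  "bigtheta_on D f g \<longleftrightarrow> bigo_on D f g \<and> bigomega_on D f g"

end

theory Submission
  imports Defs "HOL-Library.Discrete_Functions" "HOL-Analysis.Harmonic_Numbers"
begin

text \<open>Every quantity in question lies between the fractional chromatic number of the graph and its
chromatic number, so two estimates suffice: an \<open>\<Omega>(n log n)\<close> lower bound for the
fractional chromatic numbers and a proper colouring of \<open>KG n\<close>, hence also of its induced
subgraph \<open>CG n\<close>, with \<open>n\<lfloor>log\<^sub>2 n\<rfloor>\<close> colours.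

\<^emph>\<open>Upper bound.\<close> Represent a partition by a part \<open>A\<close> with \<open>2|A| \<le> n\<close>. Two different
partitions are then non-nested as soon as their small parts meet and neither contains the other.
So the sets of size at most \<open>n/2\<close> have to be split into intersecting antichains. Colouring each
\<open>A\<close> by a suitable element of \<open>A\<close>, the pivot, makes the colour classes intersecting; the
question is how to make them antichains without paying for every size separately. If \<open>A \<subset> C\<close>
share the pivot \<open>i\<close>, then \<open>i\<close> has rank in \<open>A\<close> at most its rank in \<open>C\<close>. Hence it is enough that the
rank of the pivot strictly \<^emph>\<open>decreases\<close> as the size grows. For sizes \<open>k\<close> with
\<open>2^j \<le> k < 2^(j+1)\<close> the rank \<open>2^(j+1) - k\<close> does this, and it lies between \<open>1\<close> and \<open>k\<close>.
Each of the \<open>\<lfloor>log\<^sub>2 n\<rfloor>\<close> dyadic scales thus costs \<open>n\<close> colours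
(\<open>not_psubset_of_same_pivot\<close>, \<open>KG_proper_coloring\<close>).

\<^emph>\<open>Lower bound.\<close> By linear programming duality, weights on the vertices that sum to at most
\<open>1\<close> on each independent set bound the fractional chromatic number from below by the total weight
(\<open>fractional_chromatic_number_ge\<close>). Take the partitions cut out by an interval of length
\<open>l \<le> n/2\<close> and give them weight \<open>1/l\<close>. In a pairwise non-nested family every other interval has
an end point at one of the \<open>l - 1\<close> gaps inside a given member of length \<open>l\<close>, and these end points are
distinct, so the family has at most \<open>l\<close> members (\<open>card_crossing_le_length\<close>). Choosing the shortest member shows that its weight is
at most \<open>1\<close> (\<open>crossing_weight_le_1\<close>), while the total weight is of order \<open>n\<close> times a harmonic
number.\<close>

section \<open>Chromatic and fractional chromatic numbers\<close>

lemma finite_independent_sets: "finite (verts G) \<Longrightarrow> finite (independent_sets G)"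
  by (rule finite_subset[of _ "Pow (verts G)"]) (auto simp: independent_sets_def)

text \<open>The colour classes of a proper colouring are independent sets covering the vertices, and giving
weight \<open>1\<close> to each of them is a fractional colouring.\<close>

lemma fractional_coloring_of_proper:
  assumes fin: "finite (verts G)" and c: "proper_coloring G k c"
  shows "\<exists>w. fractional_coloring G w \<and> (\<Sum>S\<in>independent_sets G. w S) \<le> real k"
proof -
  define cls where "cls i = {v \<in> verts G. c v = i}" for i
  define w :: "'a set \<Rightarrow> real" where "w S = of_bool (S \<in> cls ` {..<k})" for S
  have ind: "cls i \<in> independent_sets G" for i
    using c by (fastforce simp: cls_def independent_sets_def proper_coloring_def)
  note fI = finite_independent_sets[OF fin]
  have "(\<Sum>S | S \<in> independent_sets G \<and> v \<in> S. w S) \<ge> 1" if "v \<in> verts G" for v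
  proof -
    have "c v < k" using c that by (simp add: proper_coloring_def)
    then have "w (cls (c v)) = 1" by (auto simp: w_def)
    moreover have "w (cls (c v)) \<le> (\<Sum>S | S \<in> independent_sets G \<and> v \<in> S. w S)"
      by (rule member_le_sum) (use fI ind that in \<open>auto simp: w_def cls_def\<close>)
    ultimately show ?thesis by simp
  qed
  then have "fractional_coloring G w"
    by (auto simp: fractional_coloring_def w_def)
  moreover have "(\<Sum>S\<in>independent_sets G. w S) = real (card (independent_sets G \<inter> cls ` {..<k}))"
    using fI by (simp add: w_def of_bool_def sum.If_cases Int_def)
  moreover have "card (independent_sets G \<inter> cls ` {..<k}) \<le> k"
    by (metis card_image_le card_lessThan card_mono finite_imageI finite_lessThan inf_le2 le_trans)
  ultimately show ?thesis by (metis of_nat_le_iff)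
qed

lemma fractional_chromatic_number_le:
  assumes "finite (verts G)" and "proper_coloring G k c"
  shows "fractional_chromatic_number G \<le> real k"
proof -
  obtain w where w: "fractional_coloring G w" "(\<Sum>S\<in>independent_sets G. w S) \<le> real k"
    using fractional_coloring_of_proper[OF assms] by blast
  have "bdd_below {\<Sum>S\<in>independent_sets G. w S | w. fractional_coloring G w}"
    by (rule bdd_belowI[of _ 0]) (auto simp: fractional_coloring_def intro!: sum_nonneg)
  then show ?thesis unfolding fractional_chromatic_number_def
    using w by (intro cInf_lower2[OF _ w(2)]) auto
qed

lemma proper_coloring_chromatic_number:
  "proper_coloring G k c \<Longrightarrow> \<exists>c'. proper_coloring G (chromatic_number G) c'"
  unfolding chromatic_number_def by (rule LeastI[of "\<lambda>k. \<exists>c. proper_coloring G k c"]) blast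

lemma chromatic_number_le: "proper_coloring G k c \<Longrightarrow> chromatic_number G \<le> k"
  unfolding chromatic_number_def by (rule Least_le) blast

lemma fractional_le_chromatic_number:
  assumes "finite (verts G)" and "proper_coloring G k c"
  shows "fractional_chromatic_number G \<le> real (chromatic_number G)"
  using proper_coloring_chromatic_number[OF assms(2)] fractional_chromatic_number_le[OF assms(1)]
  by blast

text \<open>Weak duality: \<open>y\<close> is a feasible point of the dual linear program, with vertices indexed by
\<open>I\<close> through \<open>p\<close>. Summing \<open>w S * y i\<close> over all incidences \<open>p i \<in> S\<close> in both orders compares the
total of \<open>y\<close> with the total of \<open>w\<close>. The proper colouring provides a fractional colouring, so
that the infimum is taken over a nonempty set.\<close>

lemma fractional_chromatic_number_ge:
  fixes y :: "'i \<Rightarrow> real"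
  assumes fin: "finite (verts G)" and col: "proper_coloring G k c"
    and I: "finite I" "p ` I \<subseteq> verts G" and y0: "\<And>i. i \<in> I \<Longrightarrow> y i \<ge> 0"
    and y1: "\<And>S. S \<in> independent_sets G \<Longrightarrow> (\<Sum>i | i \<in> I \<and> p i \<in> S. y i) \<le> 1"
  shows "(\<Sum>i\<in>I. y i) \<le> fractional_chromatic_number G"
  unfolding fractional_chromatic_number_def
proof (rule cInf_greatest)
  show "{\<Sum>S\<in>independent_sets G. w S | w. fractional_coloring G w} \<noteq> {}"
    using fractional_coloring_of_proper[OF fin col] by blast
next
  fix t assume "t \<in> {\<Sum>S\<in>independent_sets G. w S | w. fractional_coloring G w}"
  then obtain w where t: "t = (\<Sum>S\<in>independent_sets G. w S)" and w: "fractional_coloring G w"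
    by blast
  note fI = finite_independent_sets[OF fin]
  have "(\<Sum>i\<in>I. y i) \<le> (\<Sum>i\<in>I. y i * (\<Sum>S | S \<in> independent_sets G \<and> p i \<in> S. w S))"
  proof (rule sum_mono)
    fix i assume i: "i \<in> I"
    then have "1 \<le> (\<Sum>S | S \<in> independent_sets G \<and> p i \<in> S. w S)"
      using w I(2) by (auto simp: fractional_coloring_def)
    from mult_left_mono[OF this y0[OF i]]
    show "y i \<le> y i * (\<Sum>S | S \<in> independent_sets G \<and> p i \<in> S. w S)" by simp
  qed
  also have "\<dots> = (\<Sum>i\<in>I. \<Sum>S | S \<in> independent_sets G \<and> p i \<in> S. w S * y i)"
    by (simp add: sum_distrib_left mult.commute)
  also have "\<dots> = (\<Sum>S\<in>independent_sets G. \<Sum>i | i \<in> I \<and> p i \<in> S. w S * y i)"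
    by (rule sum.swap_restrict) (use I fI in auto)
  also have "\<dots> = (\<Sum>S\<in>independent_sets G. w S * (\<Sum>i | i \<in> I \<and> p i \<in> S. y i))"
    by (simp add: sum_distrib_left)
  also have "\<dots> \<le> t"
    unfolding t using w y1 by (intro sum_mono mult_right_le_one_le)
      (auto simp: fractional_coloring_def intro!: sum_nonneg y0)
  finally show "(\<Sum>i\<in>I. y i) \<le> t" .
qed

section \<open>Colouring the total Kneser graph\<close>

lemma bipartition_small_side:
  assumes "P \<in> bipartitions n"
  obtains A where "A \<noteq> {}" "A \<subseteq> {1..n}" "2 * card A \<le> n" "P = {A, {1..n} - A}"
proof -
  obtain A B where AB: "A \<noteq> {}" "B \<noteq> {}" "A \<inter> B = {}" "A \<union> B = {1..n}" "P = {A, B}"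
    using assms unfolding bipartitions_def by blast
  then have "finite A" "finite B" by (metis finite_Un finite_atLeastAtMost)+
  then have "card A + card B = n" using AB card_Un_disjoint by (metis card_atLeastAtMost diff_Suc_1)
  then have "2 * card A \<le> n \<or> 2 * card B \<le> n" by linarith
  moreover have "P = {A, {1..n} - A}" "P = {B, {1..n} - B}"
    using AB by (auto simp flip: AB(4))
  moreover have "A \<subseteq> {1..n}" "B \<subseteq> {1..n}" using AB by blast+
  ultimately show thesis using that[of A] that[of B] AB(1,2) by metis
qed

text \<open>Up to \<open>i\<close> the number of elements of \<open>A\<close> grows in steps of at most one, and it grows only at
elements of \<open>A\<close>; the first \<open>i\<close> where it reaches \<open>r\<close> is therefore the \<open>r\<close>-th smallest element.\<close>

lemma rank_element_exists:
  fixes A :: "nat set"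
  assumes "finite A" "1 \<le> r" "r \<le> card A"
  shows "\<exists>i\<in>A. card (A \<inter> {..i}) = r"
proof -
  define i where "i = (LEAST i. r \<le> card (A \<inter> {..i}))"
  have "A \<inter> {..Max A} = A" using assms by auto
  then have ge: "r \<le> card (A \<inter> {..i})"
    unfolding i_def using assms by (intro LeastI[of "\<lambda>i. r \<le> card (A \<inter> {..i})" "Max A"]) simp
  have lt: "card (A \<inter> {..<i}) < r"
  proof (cases i)
    case 0 then show ?thesis using assms by simp
  next
    case (Suc j)
    then have "\<not> r \<le> card (A \<inter> {..j})" using not_less_Least[of j "\<lambda>i. r \<le> card (A \<inter> {..i})"]
      by (simp add: i_def)
    then show ?thesis by (simp add: Suc lessThan_Suc_atMost)
  qed
  have eq: "A \<inter> {..i} = (if i \<in> A then insert i (A \<inter> {..<i}) else A \<inter> {..<i})"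
    by (auto simp: le_less)
  have "i \<in> A" using ge lt eq by (auto split: if_splits)
  moreover have "card (A \<inter> {..i}) = Suc (card (A \<inter> {..<i}))"
    using eq \<open>i \<in> A\<close> assms by simp
  ultimately show ?thesis using ge lt by (intro bexI[of _ i]) linarith+
qed

text \<open>The rank at which the pivot of \<open>A\<close> is taken. Within one dyadic scale it counts down from
\<open>2^j\<close> to \<open>1\<close> while the size of \<open>A\<close> goes up from \<open>2^j\<close> to \<open>2^(j+1) - 1\<close>.\<close>

definition complementary_rank :: "nat set \<Rightarrow> nat" where
  "complementary_rank A = 2 ^ Suc (floor_log (card A)) - card A"

lemma card_in_dyadic_range:
  assumes "0 < k"
  shows "2 ^ floor_log k \<le> k" "k < 2 ^ Suc (floor_log k)"
  using assms floor_log_exp2_le floor_log_exp2_gt by auto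

text \<open>The antichain property of the colour classes: enlarging a set cannot lower the number of
elements up to \<open>i\<close>, whereas the prescribed rank of the pivot drops when the size grows within a
dyadic scale.\<close>

lemma not_psubset_of_same_pivot:
  assumes "finite C" "A \<noteq> {}" and scale: "floor_log (card A) = floor_log (card C)"
    and A: "card (A \<inter> {..i}) = complementary_rank A"
    and C: "card (C \<inter> {..i}) = complementary_rank C"
  shows "\<not> A \<subset> C"
proof
  assume sub: "A \<subset> C"
  then have "card A < card C" using assms psubset_card_mono by blast
  moreover have "card C < 2 ^ Suc (floor_log (card C))"
    using assms sub by (intro card_in_dyadic_range) (auto simp: card_gt_0_iff)
  ultimately have "complementary_rank C < complementary_rank A"
    using scale by (simp add: complementary_rank_def)
  moreover have "card (A \<inter> {..i}) \<le> card (C \<inter> {..i})" using assms sub by (intro card_mono) auto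
  ultimately show False using A C by simp
qed

lemma pivot_exists:
  fixes A :: "nat set"
  assumes "finite A" "A \<noteq> {}"
  shows "\<exists>i\<in>A. card (A \<inter> {..i}) = complementary_rank A"
proof -
  have "0 < card A" using assms by (simp add: card_gt_0_iff)
  from card_in_dyadic_range[OF this] show ?thesis
    using assms by (intro rank_element_exists) (auto simp: complementary_rank_def)
qed

text \<open>The colour encodes the pair of dyadic scale and pivot. A small part has size at most \<open>n/2\<close>,
so its scale \<open>j\<close> satisfies \<open>j + 1 \<le> \<lfloor>log\<^sub>2 n\<rfloor>\<close>. Of the four ways in which two partitions
can be nested, two are inclusions between the small parts, up to complements; one would make the
small parts disjoint although they share the pivot; in the last, the complement of a small part,
being at least as large as the other small part, would equal it, with the same contradiction.\<close>

lemma KG_proper_coloring: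
  "\<exists>c. proper_coloring (KG n) (n * floor_log n) c"
proof -
  define pivoted where "pivoted P A i \<longleftrightarrow> A \<subseteq> {1..n} \<and> 2 * card A \<le> n \<and> P = {A, {1..n} - A}
      \<and> i \<in> A \<and> card (A \<inter> {..i}) = complementary_rank A" for P A i
  have "\<exists>A i. pivoted P A i" if P: "P \<in> bipartitions n" for P
  proof -
    obtain A where A: "A \<noteq> {}" "A \<subseteq> {1..n}" "2 * card A \<le> n" "P = {A, {1..n} - A}"
      using P by (rule bipartition_small_side)
    have "finite A" using A(2) finite_subset by blast
    then obtain i where "i \<in> A" "card (A \<inter> {..i}) = complementary_rank A"
      using pivot_exists A(1) by blast
    with A(2,3,4) have "pivoted P A i" unfolding pivoted_def by (intro conjI)
    then show ?thesis by blast
  qed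
  then obtain sm pv where f: "\<And>P. P \<in> bipartitions n \<Longrightarrow> pivoted P (sm P) (pv P)"
    by metis
  have sm: "sm P \<subseteq> {1..n}" "2 * card (sm P) \<le> n" "pv P \<in> sm P"
      "card (sm P \<inter> {..pv P}) = complementary_rank (sm P)"
    if "P \<in> bipartitions n" for P
    using f[OF that] by (simp_all add: pivoted_def)
  have sides: "P = {sm P, {1..n} - sm P}" if "P \<in> bipartitions n" for P
    using f[OF that] unfolding pivoted_def by (elim conjE)
  define c where "c P = floor_log (card (sm P)) * n + (pv P - 1)" for P
  have pv: "1 \<le> pv P" "pv P \<le> n" if "P \<in> bipartitions n" for P
    using sm[OF that] by auto
  have fin: "finite (sm P)" if "P \<in> bipartitions n" for P
    using sm[OF that] finite_subset by blast
  have bound: "c P < n * floor_log n" if P: "P \<in> bipartitions n" for P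
  proof -
    have pos: "0 < card (sm P)" using sm[OF P] fin[OF P] by (auto simp: card_gt_0_iff)
    have "Suc (floor_log (card (sm P))) = floor_log (2 * card (sm P))"
      using floor_log_twice pos by simp
    also have "\<dots> \<le> floor_log n" using sm[OF P] by (intro floor_log_le_iff) simp
    finally have "Suc (floor_log (card (sm P))) * n \<le> floor_log n * n" by (rule mult_le_mono1)
    then show ?thesis using pv[OF P] by (simp add: c_def mult.commute)
  qed
  have proper: "c P \<noteq> c Q"
    if P: "P \<in> bipartitions n" and Q: "Q \<in> bipartitions n" and ne: "P \<noteq> Q" and nest: "nested P Q" for P Q
  proof
    assume eq: "c P = c Q"
    have dm: "(q * n + r) div n = q" "(q * n + r) mod n = r" if "r < n" for q r
      using that by simp_all
    have "pv P - 1 < n" "pv Q - 1 < n" using pv[OF P] pv[OF Q] by auto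
    from dm[OF this(1)] dm[OF this(2)]
    have "floor_log (card (sm P)) = c P div n" "pv P - 1 = c P mod n"
      "floor_log (card (sm Q)) = c Q div n" "pv Q - 1 = c Q mod n"
      unfolding c_def by (simp_all only:)
    then have sc: "floor_log (card (sm P)) = floor_log (card (sm Q))" and pveq: "pv P = pv Q"
      using eq pv[OF P] pv[OF Q] by auto
    let ?A = "sm P" and ?C = "sm Q"
    have ne': "?A \<noteq> ?C" using sides[OF P] sides[OF Q] ne by metis
    have meet: "?A \<inter> ?C \<noteq> {}" using sm[OF P] sm[OF Q] pveq by auto
    have nAC: "\<not> ?A \<subseteq> ?C"
      using not_psubset_of_same_pivot[of ?C ?A "pv P"] sm[OF P] sm[OF Q] fin[OF Q] sc pveq ne' by auto
    have nCA: "\<not> ?C \<subseteq> ?A"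
      using not_psubset_of_same_pivot[of ?A ?C "pv P"] sm[OF P] sm[OF Q] fin[OF P] sc pveq ne' by auto
    have "{1..n} - ?A \<noteq> ?C" using meet by auto
    moreover have "{1..n} - ?A = ?C" if "{1..n} - ?A \<subseteq> ?C"
    proof (rule card_seteq[OF fin[OF Q] that])
      have "card ({1..n} - ?A) = n - card ?A" using sm[OF P] fin[OF P] by (subst card_Diff_subset) auto
      then show "card ?C \<le> card ({1..n} - ?A)" using sm[OF P] sm[OF Q] by simp
    qed
    ultimately have nAc: "\<not> {1..n} - ?A \<subseteq> ?C" by blast
    have "\<exists>X\<in>{?A, {1..n} - ?A}. \<exists>Y\<in>{?C, {1..n} - ?C}. X \<subseteq> Y"
      using nest sides[OF P] sides[OF Q] unfolding nested_def by metis
    then consider "?A \<subseteq> ?C" | "?A \<subseteq> {1..n} - ?C" | "{1..n} - ?A \<subseteq> ?C" | "{1..n} - ?A \<subseteq> {1..n} - ?C"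
      by blast
    then show False using nAC nCA nAc meet sm(1)[OF P] sm(1)[OF Q] by cases blast+
  qed
  have "proper_coloring (KG n) (n * floor_log n) c"
    unfolding proper_coloring_def
  proof (intro conjI ballI impI)
    fix P Q assume "P \<in> verts (KG n)" "Q \<in> verts (KG n)" "{P, Q} \<in> edges (KG n)"
    then obtain P' Q' where PQ: "P' \<in> bipartitions n" "Q' \<in> bipartitions n" "P' \<noteq> Q'" "nested P' Q'"
      "{P, Q} = {P', Q'}" by (auto simp: KG_def)
    then show "c P \<noteq> c Q" using proper[OF PQ(1-4)] by (auto simp: doubleton_eq_iff)
  qed (simp add: KG_def bound)
  then show ?thesis by blast
qed

lemma finite_bipartitions: "finite (bipartitions n)"
  by (rule finite_subset[of _ "Pow (Pow {1..n})"]) (auto simp: bipartitions_def)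

lemma proper_coloring_induced_subgraph:
  "proper_coloring G k c \<Longrightarrow> proper_coloring (induced_subgraph G W) k c"
  by (auto simp: proper_coloring_def induced_subgraph_def)

section \<open>The fractional lower bound from crossing intervals\<close>

definition interval :: "nat \<times> nat \<Rightarrow> nat set" where
  "interval = (\<lambda>(a, l). {a..<a + l})"

definition interval_partition :: "nat \<Rightarrow> nat \<times> nat \<Rightarrow> nat set set" where
  "interval_partition n x = {interval x, {1..n} - interval x}"

text \<open>Restricting both the start and the length to at most \<open>n div 2\<close> keeps the intervals inside
\<open>{1..n - 1}\<close>. So none of them wraps around, and \<open>n\<close> tells the interval from its complement, which
makes \<open>interval_partition n\<close> injective on the indices.\<close>

definition interval_indices :: "nat \<Rightarrow> (nat \<times> nat) set" where
  "interval_indices n = {1..n div 2} \<times> {1..n div 2}"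

lemma interval_index_bounds:
  assumes "(a, l) \<in> interval_indices n"
  shows "1 \<le> a" "1 \<le> l" "a + l \<le> n"
  using assms by (auto simp: interval_indices_def)

lemma interval_partition_in_CG:
  assumes "x \<in> interval_indices n"
  shows "interval_partition n x \<in> verts (CG n)"
proof -
  obtain a l where x: "x = (a, l)" by force
  note b = interval_index_bounds[OF assms[unfolded x]]
  have "interval x = cyclic_shift n (a - 1) ` {1..l}"
  proof (intro equalityI subsetI)
    fix z assume "z \<in> interval x"
    then have "z = cyclic_shift n (a - 1) (z - a + 1)" "z - a + 1 \<in> {1..l}"
      using b by (auto simp: x interval_def cyclic_shift_def)
    then show "z \<in> cyclic_shift n (a - 1) ` {1..l}" by blast
  qed (use b in \<open>auto simp: x interval_def cyclic_shift_def\<close>)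
  then have 1: "cyclic_interval n (interval x)"
    unfolding cyclic_interval_def using b by (intro bexI[of _ l] exI[of _ "a - 1"]) auto
  \<comment> \<open>The complement starts right after the interval and wraps around past \<open>n\<close>.\<close>
  let ?s = "a + l - 1"
  have "{1..n} - interval x = cyclic_shift n ?s ` {1..n - l}"
  proof (intro equalityI subsetI)
    fix z assume z: "z \<in> {1..n} - interval x"
    show "z \<in> cyclic_shift n ?s ` {1..n - l}"
    proof (cases "z < a")
      case True
      have "z + n - ?s - 1 + ?s = (z - 1) + n" using z b by auto
      moreover have "((z - 1) + n) mod n = z - 1"
        unfolding mod_add_self2 using z by (intro mod_less) auto
      ultimately have "cyclic_shift n ?s (z + n - ?s) = z - 1 + 1"
        unfolding cyclic_shift_def by (simp only:)
      then have "z = cyclic_shift n ?s (z + n - ?s)" using z by simp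
      then show ?thesis using z b True by (intro image_eqI[of _ _ "z + n - ?s"]) auto
    next
      case False
      then have "z = cyclic_shift n ?s (z - ?s)"
        using z b by (auto simp: cyclic_shift_def x interval_def)
      then show ?thesis using z b False
        by (intro image_eqI[of _ _ "z - ?s"]) (auto simp: x interval_def)
    qed
  next
    fix z assume "z \<in> cyclic_shift n ?s ` {1..n - l}"
    then obtain t where t: "1 \<le> t" "t \<le> n - l" "z = (t - 1 + ?s) mod n + 1"
      by (auto simp: cyclic_shift_def)
    show "z \<in> {1..n} - interval x"
    proof (cases "t - 1 + ?s < n")
      case True
      then show ?thesis using t b by (auto simp: x interval_def)
    next
      case False
      then have "z = t - 1 + ?s - n + 1" using t b by (simp add: mod_if)
      then show ?thesis using t b False by (auto simp: x interval_def)
    qed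
  qed
  then have 2: "cyclic_interval n ({1..n} - interval x)"
    unfolding cyclic_interval_def using b by (intro bexI[of _ "n - l"] exI[of _ ?s]) auto
  have "a \<in> interval x" "n \<in> {1..n} - interval x" "interval x \<subseteq> {1..n}"
    using b by (auto simp: x interval_def)
  then have "interval_partition n x \<in> bipartitions n"
    unfolding interval_partition_def bipartitions_def by blast
  then show ?thesis
    using 1 2 by (auto simp: CG_def induced_subgraph_def KG_def interval_partition_def)
qed

lemma inj_on_interval_partition: "inj_on (interval_partition n) (interval_indices n)"
proof (rule inj_onI)
  fix x x' assume x: "x \<in> interval_indices n" "x' \<in> interval_indices n"
    and eq: "interval_partition n x = interval_partition n x'"
  obtain a l a' l' where xx: "x = (a, l)" "x' = (a', l')" by force
  note b = interval_index_bounds[OF x(1)[unfolded xx]] interval_index_bounds[OF x(2)[unfolded xx]]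
  have "n \<notin> interval x" "n \<notin> interval x'" "n \<in> {1..n}"
    using b by (auto simp: interval_def xx)
  then have "interval x = interval x'" using eq unfolding interval_partition_def doubleton_eq_iff by blast
  then show "x = x'" using b by (auto simp: interval_def xx atLeastLessThan_eq_iff)
qed

text \<open>For two intervals in \<open>{1..n - 1}\<close> this is what remains of being non-nested as partitions: both
complements contain \<open>n\<close>, so they always meet.\<close>

definition crossing_intervals :: "nat \<times> nat \<Rightarrow> nat \<times> nat \<Rightarrow> bool" where
  "crossing_intervals x y \<longleftrightarrow> interval x \<inter> interval y \<noteq> {} \<and>
     \<not> interval x \<subseteq> interval y \<and> \<not> interval y \<subseteq> interval x"

text \<open>View each interval as a chord joining two of the gaps between consecutive integers. A chord that
crosses the chord of \<open>(a, l)\<close> has exactly one end point among the \<open>l - 1\<close> gaps strictly inside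
that interval, and crossing chords have distinct end points. The function \<open>cut\<close> below sends an
interval to this inner end point, naming a gap by the integer to its right; \<open>(a, l)\<close> itself is sent
to its left end \<open>a\<close>.\<close>

lemma card_crossing_le_length:
  assumes cross: "pairwise crossing_intervals T" and mem: "(a, l) \<in> T" "l \<ge> 1"
  shows "card T \<le> l"
proof -
  define cut where "cut = (\<lambda>(c, k). if a \<le> c then c else c + k)"
  have "cut ` T \<subseteq> {a..<a + l}"
  proof (clarify)
    fix c k assume "(c, k) \<in> T"
    then have "(c, k) = (a, l) \<or> crossing_intervals (c, k) (a, l)"
      using cross mem by (auto simp: pairwise_def)
    then show "cut (c, k) \<in> {a..<a + l}"
      using mem by (auto simp: cut_def crossing_intervals_def interval_def)
  qed
  moreover have "inj_on cut T"
  proof (rule inj_onI, rule ccontr)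
    fix x y assume xy: "x \<in> T" "y \<in> T" "cut x = cut y" "x \<noteq> y"
    obtain c k d m where cd: "x = (c, k)" "y = (d, m)" by force
    have "crossing_intervals (c, k) (d, m)" using cross xy cd by (auto simp: pairwise_def)
    then show False using xy(3) unfolding cd
      by (auto simp: cut_def crossing_intervals_def interval_def split: if_splits)
  qed
  ultimately have "card T \<le> card {a..<a + l}"
    by (metis card_inj_on_le finite_atLeastLessThan)
  then show ?thesis by simp
qed

text \<open>The family has at most as many members as the length of its shortest member, and no weight exceeds
the one of that member.\<close>

lemma crossing_weight_le_1:
  assumes "finite T" and cross: "pairwise crossing_intervals T" and pos: "\<And>x. x \<in> T \<Longrightarrow> snd x \<ge> 1"
  shows "(\<Sum>x\<in>T. 1 / real (snd x)) \<le> 1"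
proof (cases "T = {}")
  case False
  then obtain x0 where x0: "x0 \<in> T" "\<And>x. x \<in> T \<Longrightarrow> snd x0 \<le> snd x"
    using ex_min_if_finite[of "snd ` T"] assms(1) by (metis arg_min_if_finite(1) arg_min_least)
  have "(\<Sum>x\<in>T. 1 / real (snd x)) \<le> real (card T) * (1 / real (snd x0))"
    using x0 pos by (intro sum_bounded_above) (auto simp: frac_le Suc_le_eq)
  also have "\<dots> \<le> 1"
    using card_crossing_le_length[OF cross, of "fst x0" "snd x0"] x0 pos[of x0]
    by (simp add: divide_le_eq)
  finally show ?thesis .
qed simp

lemma interval_subset:
  assumes "x \<in> interval_indices n"
  shows "interval x \<subseteq> {1..n}"
proof -
  obtain a l where x: "x = (a, l)" by force
  show ?thesis using interval_index_bounds[OF assms[unfolded x]] by (auto simp: x interval_def)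
qed

lemma crossing_if_not_nested:
  assumes x: "x \<in> interval_indices n" and y: "y \<in> interval_indices n"
    and nn: "\<not> nested (interval_partition n x) (interval_partition n y)"
  shows "crossing_intervals x y"
proof -
  have "interval x \<subseteq> {1..n}" "interval y \<subseteq> {1..n}"
    using interval_subset x y by blast+
  with nn show ?thesis
    by (auto simp: crossing_intervals_def nested_def interval_partition_def)
qed

text \<open>Stated for any graph that contains the interval partitions and joins nested vertices, so as to
cover both \<open>CG n\<close> and \<open>KG n\<close>. The total weight is a harmonic number for each of the \<open>n div 2\<close> starting points.\<close>

lemma crossing_harmonic_le:
  assumes fin: "finite (verts G)" and col: "proper_coloring G k c"
    and sub: "interval_partition n ` interval_indices n \<subseteq> verts G"
    and edges: "\<And>P Q. P \<in> verts G \<Longrightarrow> Q \<in> verts G \<Longrightarrow> P \<noteq> Q \<Longrightarrow> nested P Q \<Longrightarrow> {P, Q} \<in> edges G"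
  shows "real (n div 2) * harm (n div 2) \<le> fractional_chromatic_number G"
proof -
  let ?I = "interval_indices n"
  have finI: "finite ?I" by (simp add: interval_indices_def)
  have "(\<Sum>x\<in>?I. 1 / real (snd x)) \<le> fractional_chromatic_number G"
  proof (rule fractional_chromatic_number_ge[OF fin col finI sub])
    fix S assume S: "S \<in> independent_sets G"
    let ?T = "{x. x \<in> ?I \<and> interval_partition n x \<in> S}"
    have "pairwise crossing_intervals ?T"
    proof (rule pairwiseI)
      fix x y assume xy: "x \<in> ?T" "y \<in> ?T" "x \<noteq> y"
      then have "interval_partition n x \<noteq> interval_partition n y"
        using inj_on_interval_partition by (auto dest: inj_onD)
      moreover have "{interval_partition n x, interval_partition n y} \<notin> edges G"
        using S xy by (auto simp: independent_sets_def)
      ultimately have "\<not> nested (interval_partition n x) (interval_partition n y)"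
        using edges sub xy by blast
      then show "crossing_intervals x y" using crossing_if_not_nested xy by blast
    qed
    then show "(\<Sum>x\<in>?T. 1 / real (snd x)) \<le> 1"
      using finI by (intro crossing_weight_le_1) (auto simp: interval_indices_def)
  qed simp
  also have "(\<Sum>x\<in>?I. 1 / real (snd x)) = (\<Sum>a\<in>{1..n div 2}. \<Sum>l\<in>{1..n div 2}. 1 / real l)"
    by (simp only: interval_indices_def sum.cartesian_product case_prod_unfold)
  also have "\<dots> = real (n div 2) * harm (n div 2)"
    by (simp add: harm_def inverse_eq_divide)
  finally show ?thesis .
qed

lemma harmonic_ge_n_ln_n:
  assumes "n \<ge> 2"
  shows "real n * ln (real n) \<le> 6 * (real (n div 2) * harm (n div 2))"
proof -
  let ?m = "n div 2"
  \<comment> \<open>\<open>n \<le> (?m + 1)^2\<close> bounds \<open>ln n\<close> by \<open>2 ln (?m + 1)\<close>; the other factor is \<open>n \<le> 3 ?m\<close>.\<close>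
  have "n \<le> 3 * ?m" "n \<le> 2 * ?m + 1" using assms by presburger+
  then have m: "real n \<le> 3 * real ?m" and m': "real n \<le> 2 * real ?m + 1"
    using assms by linarith+
  have "real n \<le> (real ?m + 1) ^ 2"
    using m' by (simp add: power2_eq_square algebra_simps) (smt (verit) zero_le_square)
  then have "ln (real n) \<le> ln ((real ?m + 1) ^ 2)" using assms by (subst ln_le_cancel_iff) auto
  also have "\<dots> = 2 * ln (real ?m + 1)" by (simp add: ln_realpow)
  also have "\<dots> \<le> 2 * harm ?m" using ln_le_harm[of ?m] by simp
  finally have "real n * ln (real n) \<le> (3 * real ?m) * (2 * harm ?m)"
    using m assms by (intro mult_mono) auto
  then show ?thesis by simp
qed

section \<open>Asymptotics of the four chromatic numbers\<close>

lemma chromatic_numbers_sandwich: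
  assumes n: "n \<ge> 2" and G: "G = CG n \<or> G = KG n"
  shows "real n * ln (real n) \<le> 6 * fractional_chromatic_number G"
    and "fractional_chromatic_number G \<le> real (chromatic_number G)"
    and "real (chromatic_number G) \<le> 1 / ln 2 * (real n * ln (real n))"
proof -
  obtain c where "proper_coloring (KG n) (n * floor_log n) c" using KG_proper_coloring by blast
  then have col: "proper_coloring G (n * floor_log n) c"
    using G proper_coloring_induced_subgraph unfolding CG_def by blast
  have fin: "finite (verts G)"
    using G finite_bipartitions by (auto simp: CG_def induced_subgraph_def KG_def)
  have sub: "interval_partition n ` interval_indices n \<subseteq> verts G"
    using G interval_partition_in_CG by (auto simp: CG_def induced_subgraph_def)
  have edges: "{P, Q} \<in> edges G"
    if "P \<in> verts G" "Q \<in> verts G" "P \<noteq> Q" "nested P Q" for P Q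
  proof -
    have "{P, Q} \<in> edges (KG n)"
      using that G by (fastforce simp: CG_def induced_subgraph_def KG_def)
    then show ?thesis using that G by (auto simp: CG_def induced_subgraph_def)
  qed
  have "real (n div 2) * harm (n div 2) \<le> fractional_chromatic_number G"
    by (rule crossing_harmonic_le[OF fin col sub edges])
  then show "real n * ln (real n) \<le> 6 * fractional_chromatic_number G"
    using harmonic_ge_n_ln_n[OF n] by simp
  show "fractional_chromatic_number G \<le> real (chromatic_number G)"
    by (rule fractional_le_chromatic_number[OF fin col])
  have "real (chromatic_number G) \<le> real n * real (floor_log n)"
    using chromatic_number_le[OF col] by (metis of_nat_le_iff of_nat_mult)
  also have "\<dots> \<le> real n * log 2 (real n)"
    using n floor_log_exp2_le[of n] by (intro mult_left_mono le_log_of_power)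
      (auto simp: numeral_power_le_of_nat_cancel_iff)
  finally show "real (chromatic_number G) \<le> 1 / ln 2 * (real n * ln (real n))"
    by (simp add: log_def)
qed

lemma bigtheta_on_sandwich:
  assumes "C > 0" "D > 0" and hf: "\<And>x. x \<in> S \<Longrightarrow> h x \<le> D * f x"
    and fg: "\<And>x. x \<in> S \<Longrightarrow> f x \<le> g x" and gh: "\<And>x. x \<in> S \<Longrightarrow> g x \<le> C * h x"
  shows "bigtheta_on S f h" "bigtheta_on S g h"
proof -
  have "f x \<le> C * h x" if "x \<in> S" for x
    using fg[OF that] gh[OF that] by (rule order_trans)
  moreover have "h x \<le> D * g x" if "x \<in> S" for x
    using hf[OF that] mult_left_mono[OF fg[OF that], of D] \<open>D > 0\<close> by linarith
  ultimately show "bigtheta_on S f h" "bigtheta_on S g h"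
    using assms unfolding bigtheta_on_def bigomega_on_def bigo_on_def by blast+
qed

theorem theorem1p1:
  shows "bigtheta_on {2..} (\<lambda>n::nat. fractional_chromatic_number (CG n)) (\<lambda>n. real n * ln (real n))
       \<and> bigtheta_on {2..} (\<lambda>n::nat. real (chromatic_number (CG n))) (\<lambda>n. real n * ln (real n))
       \<and> bigtheta_on {2..} (\<lambda>n::nat. fractional_chromatic_number (KG n)) (\<lambda>n. real n * ln (real n))
       \<and> bigtheta_on {2..} (\<lambda>n::nat. real (chromatic_number (KG n))) (\<lambda>n. real n * ln (real n))"
proof -
  have CG: "bigtheta_on {2..} (\<lambda>n. fractional_chromatic_number (CG n)) (\<lambda>n. real n * ln (real n))"
    "bigtheta_on {2..} (\<lambda>n. real (chromatic_number (CG n))) (\<lambda>n. real n * ln (real n))"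
    by (rule bigtheta_on_sandwich[of "1 / ln 2" 6 "{2..}" _ "\<lambda>n. fractional_chromatic_number (CG n)"
          "\<lambda>n. real (chromatic_number (CG n))"];
        use chromatic_numbers_sandwich[of _ "CG _"] in simp)+
  have KG: "bigtheta_on {2..} (\<lambda>n. fractional_chromatic_number (KG n)) (\<lambda>n. real n * ln (real n))"
    "bigtheta_on {2..} (\<lambda>n. real (chromatic_number (KG n))) (\<lambda>n. real n * ln (real n))"
    by (rule bigtheta_on_sandwich[of "1 / ln 2" 6 "{2..}" _ "\<lambda>n. fractional_chromatic_number (KG n)"
          "\<lambda>n. real (chromatic_number (KG n))"];
        use chromatic_numbers_sandwich[of _ "KG _"] in simp)+
  from CG KG show ?thesis by blast
qed

end
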